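(* For $\pi\in\mathcal S_n$ define $\Delta(\pi)=\Psi^{-1}\big((\Psi(\pi))^{-1}\big)$. Then $\Delta$ is an involution on $\mathcal S_n$; $\pi$ and $\Delta(\pi)$ have the same number of cycles; and if $\pi$ has $k$ cyclic occurrences of the pattern 3--1--2 then $\Delta(\pi)$ has $k$ cyclic occurrences of the pattern 2--3--1.
   Context: $\mathcal S_n$ is the set of permutations of $[n]$. The standard cycle form writes each cycle starting with its smallest element, cycles listed in decreasing order of smallest elements. $\Psi:\mathcal S_n\to\mathcal S_n$ sends $\pi$ to the permutation whose one-line notation is the word obtained by deleting the parentheses from the standard cycle form of $\pi$; $\Psi$ is a bijection (its inverse cuts a word before each left-to-right minimum to form the cycles). $(\Psi(\pi))^{-1}$ is the group-theoretic inverse. A cyclic occurrence of 3--1--2 in $\pi$ is a triple $i<j<k$ with $w_j<w_k<w_i$ where $w=\Psi(\pi)$; a cyclic occurrence of 2--3--1 is a triple $i<j<k$ with $w_k<w_i<w_j$. *)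

theory Defs
  imports "HOL-Combinatorics.Combinatorics"
begin

text \<open>
  A permutation of \<open>[n]\<close> is a function \<open>p :: nat \<Rightarrow> nat\<close> with \<open>p permutes {1..n}\<close>; it is the
  identity outside \<open>{1..n}\<close>. Its one-line notation is \<open>p 1, p 2, \<dots>, p n\<close>.
\<close>

definition Sym :: "nat \<Rightarrow> (nat \<Rightarrow> nat) set" where
  "Sym n = {p. p permutes {1..n}}"

text \<open>The cycles as sets of elements; each fixed point counts as a cycle of length one.\<close>

definition cycle_sets :: "nat \<Rightarrow> (nat \<Rightarrow> nat) \<Rightarrow> nat set set" where
  "cycle_sets n p = orbit p ` {1..n}"

definition num_cycles :: "nat \<Rightarrow> (nat \<Rightarrow> nat) \<Rightarrow> nat" where
  "num_cycles n p = card (cycle_sets n p)"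

text \<open>
  The library's \<open>support p m\<close> is the cycle of \<open>p\<close> through \<open>m\<close> written starting with \<open>m\<close>,
  i.e. \<open>[m, p m, p (p m), \<dots>]\<close>; it is \<open>[m]\<close> if \<open>m\<close> is a fixed point.
\<close>

definition standard_cycle_form :: "nat \<Rightarrow> (nat \<Rightarrow> nat) \<Rightarrow> nat list list" where
  "standard_cycle_form n p =
     map (\<lambda>m. support p m) (rev (sorted_list_of_set (Min ` cycle_sets n p)))"

definition perm_of_word :: "nat list \<Rightarrow> nat \<Rightarrow> nat" where
  "perm_of_word w i = (if 1 \<le> i \<and> i \<le> length w then w ! (i - 1) else i)"

definition Psi :: "nat \<Rightarrow> (nat \<Rightarrow> nat) \<Rightarrow> nat \<Rightarrow> nat" where
  "Psi n p = perm_of_word (concat (standard_cycle_form n p))"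

text \<open>\<open>inv_into (Sym n) (Psi n)\<close> is the inverse of the bijection \<open>Psi n\<close> of \<open>Sym n\<close>.\<close>

definition Delta :: "nat \<Rightarrow> (nat \<Rightarrow> nat) \<Rightarrow> nat \<Rightarrow> nat" where
  "Delta n p = inv_into (Sym n) (Psi n) (inv (Psi n p))"

definition cyclic_occ_312 :: "nat \<Rightarrow> (nat \<Rightarrow> nat) \<Rightarrow> (nat \<times> nat \<times> nat) set" where
  "cyclic_occ_312 n p = {(i, j, k). 1 \<le> i \<and> i < j \<and> j < k \<and> k \<le> n \<and>
     Psi n p j < Psi n p k \<and> Psi n p k < Psi n p i}"

definition cyclic_occ_231 :: "nat \<Rightarrow> (nat \<Rightarrow> nat) \<Rightarrow> (nat \<times> nat \<times> nat) set" where
  "cyclic_occ_231 n p = {(i, j, k). 1 \<le> i \<and> i < j \<and> j < k \<and> k \<le> n \<and>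
     Psi n p k < Psi n p i \<and> Psi n p i < Psi n p j}"

end

(*
  Since every cycle starts with its minimum and the minima decrease, the word of p breaks into its
  cycles exactly at the left-to-right minima: it determines p, and the number of cycles of p is its
  number of left-to-right minima. A position i is a left-to-right minimum of w iff no j < i has
  w j < w i, a condition symmetric in positions and values, so w and its inverse have equally many.
  Similarly, reading the points (i, w i) with the axes exchanged turns each occurrence of 3-1-2 in w
  into one of 2-3-1 in the inverse of w.
*)

theory Submission
  imports Defs
begin

section \<open>Words cut into blocks at their left-to-right minima\<close>

text \<open>The order properties of a standard cycle form, kept without reference to a permutation,
  so that decoding and counting become inductions on lists of blocks.\<close>

definition std_form :: "'a::linorder list list \<Rightarrow> bool" where
  "std_form xss \<longleftrightarrow> (\<forall>xs\<in>set xss. xs \<noteq> [] \<and> (\<forall>y\<in>set (tl xs). hd xs < y)) \<and>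
     sorted_wrt (>) (map hd xss)"

lemma std_form_Cons:
  "std_form ((x # xs) # xss) \<longleftrightarrow>
     (\<forall>y\<in>set xs. x < y) \<and> (\<forall>ys\<in>set xss. hd ys < x) \<and> std_form xss"
  unfolding std_form_def by auto

text \<open>The block opened by \<open>x\<close> ends exactly where the next head, which is below
  \<open>x\<close>, appears. Hence the first block can be read off from the word alone.\<close>

lemma std_form_takeWhile:
  assumes "std_form ((x # xs) # xss)"
  shows "takeWhile (\<lambda>z. x < z) (xs @ concat xss) = xs"
proof (cases xss)
  case Nil
  with assms show ?thesis by (simp add: std_form_Cons)
next
  case (Cons ys yss)
  with assms have "ys \<noteq> []" "hd ys < x"
    by (auto simp: std_form_def)
  then obtain y ys' where "ys = y # ys'" "\<not> x < y"
    by (cases ys) auto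
  with assms Cons show ?thesis
    by (simp add: std_form_Cons takeWhile_append)
qed

text \<open>Equal words have equal first letters, so \<open>std_form_takeWhile\<close> cuts the same
  first block from both; induction handles the rest.\<close>

lemma std_form_concat_inject:
  assumes "std_form xss" "std_form yss" "concat xss = concat yss"
  shows "xss = yss"
  using assms
proof (induction xss arbitrary: yss)
  case Nil
  then show ?case by (cases yss) (auto simp: std_form_def)
next
  case (Cons xs xss)
  from Cons.prems obtain x xs' where xs: "xs = x # xs'"
    by (cases xs) (auto simp: std_form_def)
  with Cons.prems(3) obtain ys yss' where yss: "yss = ys # yss'"
    by (cases yss) auto
  with Cons.prems obtain y ys' where ys: "ys = y # ys'"
    by (cases ys) (auto simp: std_form_def)
  have eq: "x = y" "xs' @ concat xss = ys' @ concat yss'"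
    using Cons.prems(3) by (auto simp: xs yss ys)
  then have "xs' = ys'"
    using Cons.prems(1,2) std_form_takeWhile[of x xs' xss] std_form_takeWhile[of y ys' yss']
    by (simp add: xs yss ys)
  with eq Cons.prems Cons.IH[of yss'] show ?case
    by (auto simp: xs yss ys std_form_Cons)
qed

text \<open>Each block contributes its head and nothing else. Induction adds blocks on the right,
  since a later block does not affect which earlier positions are minima.\<close>

lemma card_left_to_right_minima:
  assumes "std_form xss"
  shows "card {i. i < length (concat xss) \<and> (\<forall>j<i. concat xss ! i < concat xss ! j)} = length xss"
  using assms
proof (induction xss rule: rev_induct)
  case Nil
  then show ?case by simp
next
  case (snoc ms xss)
  let ?u = "concat xss"
  let ?L = "\<lambda>w. {i. i < length w \<and> (\<forall>j<i. w ! i < w ! j)}"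
  have std: "std_form xss"
    using snoc.prems by (auto simp: std_form_def sorted_wrt_append)
  from snoc.prems obtain m r where ms: "ms = m # r"
    by (cases ms) (auto simp: std_form_def)
  have m_less_r: "\<forall>y\<in>set r. m < y"
    using snoc.prems by (auto simp: std_form_def ms)
  \<comment> \<open>Heads decrease, so \<open>m\<close> is below the head of the block of
    \<open>y\<close>, which is at most \<open>y\<close>.\<close>
  have m_less_u: "m < y" if "y \<in> set ?u" for y
  proof -
    obtain xs where xs: "xs \<in> set xss" "y \<in> set xs"
      using \<open>y \<in> set ?u\<close> by auto
    then have "m < hd xs"
      using snoc.prems by (auto simp: std_form_def ms sorted_wrt_append)
    moreover have "xs \<noteq> [] \<and> (\<forall>z\<in>set (tl xs). hd xs < z)"
      using xs std by (auto simp: std_form_def)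
    ultimately show "m < y"
      using xs(2) by (cases xs) auto
  qed
  have "?L (?u @ m # r) = insert (length ?u) (?L ?u)"
  proof (intro set_eqI)
    fix i
    consider "i < length ?u" | "i = length ?u" | "i > length ?u" by linarith
    then show "i \<in> ?L (?u @ m # r) \<longleftrightarrow> i \<in> insert (length ?u) (?L ?u)"
    proof cases
      case 1
      then show ?thesis by (auto simp: nth_append)
    next
      case 2
      then show ?thesis using m_less_u nth_mem[of _ ?u] by (simp add: nth_append del: in_set_conv_nth)
    next
      case 3
      \<comment> \<open>A position in the tail of the last block is beaten by the head
        \<open>m\<close> at position \<open>length ?u\<close>.\<close>
      have False if "i \<in> ?L (?u @ m # r)"
      proof -
        obtain k where k: "i = length ?u + Suc k"
          using 3 less_natE by (metis add_Suc_right)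
        have "(?u @ m # r) ! i < (?u @ m # r) ! length ?u"
          using that 3 by blast
        then have "r ! k < m"
          unfolding k by (simp add: nth_append)
        moreover have "k < length r"
          using that by (simp add: k)
        ultimately show False
          using m_less_r nth_mem by fastforce
      qed
      then show ?thesis using 3 by auto
    qed
  qed
  then show ?case
    using snoc.IH[OF std] by (simp add: ms)
qed

section \<open>The standard cycle form and its word\<close>

lemma Min_orbit:
  fixes p :: "nat \<Rightarrow> nat"
  assumes "p permutes {1..n}"
  shows "Min (orbit p x) \<in> orbit p x" "orbit p (Min (orbit p x)) = orbit p x"
proof -
  have cyc: "cyclic_on p (orbit p x)"
    using assms by (rule cyclic_on_orbit) simp
  show "Min (orbit p x) \<in> orbit p x"
    using finite_cyclic_on[OF cyc] orbit_nonempty by (rule Min_in)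
  with cyc show "orbit p (Min (orbit p x)) = orbit p x"
    by (rule orbit_cyclic_eq3)
qed

lemma set_support_eq_orbit:
  assumes "permutation p"
  shows "set (support p x) = orbit p x"
  unfolding support_set[OF assms] orbit_altdef_permutation[OF assms] by auto

lemma set_standard_cycle_form:
  assumes "p permutes {1..n}"
  shows "set (standard_cycle_form n p) = (\<lambda>x. support p (Min (orbit p x))) ` {1..n}"
  unfolding standard_cycle_form_def cycle_sets_def by (simp add: image_image)

text \<open>A cycle is recovered from its minimum as the orbit of that minimum, so listing minima
  instead of cycles preserves the count.\<close>

lemma inj_on_Min_cycle_sets:
  assumes "p permutes {1..n}"
  shows "inj_on Min (cycle_sets n p)"
  unfolding cycle_sets_def by (intro inj_onI) (metis Min_orbit(2)[OF assms] imageE)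

lemma length_standard_cycle_form:
  assumes "p permutes {1..n}"
  shows "length (standard_cycle_form n p) = num_cycles n p"
  unfolding standard_cycle_form_def num_cycles_def
  using card_image[OF inj_on_Min_cycle_sets[OF assms]] by simp

text \<open>The least power is positive, so the list of iterates is nonempty and begins with the
  zeroth iterate \<open>m\<close>.\<close>

lemma support_eq_Cons:
  assumes "permutation p"
  shows "support p m = m # tl (support p m)"
proof -
  obtain k where "least_power p m = Suc k"
    using least_power_of_permutation(2)[OF assms, of m] gr0_implies_Suc by blast
  then show ?thesis
    by (simp add: upt_conv_Cons del: upt_Suc)
qed

lemma std_form_standard_cycle_form:
  assumes "p permutes {1..n}"
  shows "std_form (standard_cycle_form n p)"
  unfolding std_form_def
proof (intro conjI ballI)
  have perm: "permutation p"
    using assms permutation_permutes by blast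
  have hd: "hd (support p m) = m" for m
    by (metis support_eq_Cons[OF perm] list.sel(1))
  have "map hd (standard_cycle_form n p) = rev (sorted_list_of_set (Min ` cycle_sets n p))"
    unfolding standard_cycle_form_def map_map o_def hd by simp
  then show "sorted_wrt (>) (map hd (standard_cycle_form n p))"
    using strict_sorted_list_of_set by (simp add: sorted_wrt_rev del: map_map)
  fix xs assume "xs \<in> set (standard_cycle_form n p)"
  then obtain x where xs: "xs = support p (Min (orbit p x))"
    unfolding set_standard_cycle_form[OF assms] by auto
  show "xs \<noteq> []"
    unfolding xs by (metis support_eq_Cons[OF perm] list.distinct(1))
  fix y assume y: "y \<in> set (tl xs)"
  have Cons: "xs = Min (orbit p x) # tl xs"
    unfolding xs by (rule support_eq_Cons[OF perm])
  have "distinct xs"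
    \<comment> \<open>Distinctness turns the weak bound by the minimum into the strict inequality on
      the tail.\<close>
    unfolding xs by (rule cycle_of_permutation[OF perm])
  then have "y \<noteq> Min (orbit p x)"
    using y by (subst (asm) Cons) auto
  moreover have "set xs = orbit p x"
    unfolding xs set_support_eq_orbit[OF perm] by (rule Min_orbit(2)[OF assms])
  then have "y \<in> orbit p x"
    using y list.set_sel(2)[OF \<open>xs \<noteq> []\<close>] by blast
  then have "Min (orbit p x) \<le> y"
    using assms by (intro Min_le finite_cyclic_on[OF cyclic_on_orbit]) auto
  ultimately show "hd xs < y"
    by (subst Cons) simp
qed

lemma standard_cycle_form_inject:
  assumes p: "p permutes {1..n}" and q: "q permutes {1..n}"
    and eq: "standard_cycle_form n p = standard_cycle_form n q"
  shows "p = q"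
proof
  fix x
  have perm: "permutation p" "permutation q"
    using p q permutation_permutes by blast+
  show "p x = q x"
  proof (cases "x \<in> {1..n}")
    case True
    let ?s = "support p (Min (orbit p x))"
    have x: "x \<in> set ?s"
      unfolding set_support_eq_orbit[OF perm(1)] Min_orbit(2)[OF p]
      by (rule permutation_self_in_orbit[OF perm(1)])
    have "?s \<in> set (standard_cycle_form n q)"
      unfolding eq[symmetric] set_standard_cycle_form[OF p] using True by blast
    then obtain m where m: "?s = support q m"
      unfolding set_standard_cycle_form[OF q] by blast
    \<comment> \<open>Both \<open>p x\<close> and \<open>q x\<close> are the cyclic successor of
      \<open>x\<close> in the same list \<open>?s\<close>.\<close>
    show ?thesis
      using cycle_restrict[OF perm(1) x] cycle_restrict[OF perm(2), of x m] x
      unfolding m by simp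
  next
    case False
    with p q show ?thesis by (simp add: permutes_not_in)
  qed
qed

lemma set_concat_standard_cycle_form:
  assumes "p permutes {1..n}"
  shows "set (concat (standard_cycle_form n p)) = {1..n}"
proof -
  have perm: "permutation p"
    using assms permutation_permutes by blast
  have "set (concat (standard_cycle_form n p)) = (\<Union>x\<in>{1..n}. orbit p x)"
    unfolding set_concat set_standard_cycle_form[OF assms] image_image
      set_support_eq_orbit[OF perm] Min_orbit(2)[OF assms] by simp
  also have "\<dots> = {1..n}"
    using permutes_orbit_subset[OF assms] permutation_self_in_orbit[OF perm] by blast
  finally show ?thesis .
qed

text \<open>Three facts combine: no cycle is listed twice, no cycle repeats an element, and two
  orbits sharing an element coincide.\<close>

lemma distinct_concat_standard_cycle_form:
  assumes "p permutes {1..n}"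
  shows "distinct (concat (standard_cycle_form n p))"
proof (rule distinct_concat)
  have perm: "permutation p"
    using assms permutation_permutes by blast
  \<comment> \<open>The starting point is the first entry of the list.\<close>
  have "inj (support p)"
    by (rule injI) (metis support_eq_Cons[OF perm] list.inject)
  then show "distinct (standard_cycle_form n p)"
    unfolding standard_cycle_form_def by (simp add: distinct_map inj_on_subset[OF _ subset_UNIV])
  show "distinct xs" if "xs \<in> set (standard_cycle_form n p)" for xs
    using that cycle_of_permutation[OF perm] unfolding set_standard_cycle_form[OF assms] by blast
  fix xs ys
  assume "xs \<in> set (standard_cycle_form n p)" "ys \<in> set (standard_cycle_form n p)" and "xs \<noteq> ys"
  then obtain x y where xy: "xs = support p (Min (orbit p x))" "ys = support p (Min (orbit p y))"
    unfolding set_standard_cycle_form[OF assms] by blast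
  show "set xs \<inter> set ys = {}"
  proof (rule ccontr)
    assume "set xs \<inter> set ys \<noteq> {}"
    then obtain z where "z \<in> orbit p x" "z \<in> orbit p y"
      unfolding xy set_support_eq_orbit[OF perm] Min_orbit(2)[OF assms] by blast
    then have "orbit p x = orbit p y"
      using orbit_cyclic_eq3[OF cyclic_on_orbit[OF assms]] by (metis finite_atLeastAtMost)
    with \<open>xs \<noteq> ys\<close> show False
      by (simp add: xy)
  qed
qed

lemma length_concat_standard_cycle_form:
  assumes "p permutes {1..n}"
  shows "length (concat (standard_cycle_form n p)) = n"
  using distinct_card[OF distinct_concat_standard_cycle_form[OF assms]]
  unfolding set_concat_standard_cycle_form[OF assms] by simp

section \<open>One-line notation and bijectivity of \<open>Psi\<close>\<close>

lemma perm_of_word_permutes: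
  assumes "distinct w" "set w = {1..n}"
  shows "perm_of_word w permutes {1..n}"
proof (rule bij_imp_permutes)
  have len: "length w = n"
    using distinct_card[OF assms(1)] assms(2) by simp
  have "inj_on (perm_of_word w) {1..n}"
    using assms(1) by (auto simp: inj_on_def perm_of_word_def len nth_eq_iff_index_eq)
  moreover have "perm_of_word w ` {1..n} \<subseteq> {1..n}"
  proof clarify
    fix i assume i: "i \<in> {1..n}"
    then have "w ! (i - 1) \<in> set w"
      by (intro nth_mem) (auto simp: len)
    then show "perm_of_word w i \<in> {1..n}"
      using i by (simp add: perm_of_word_def len assms(2))
  qed
  ultimately show "bij_betw (perm_of_word w) {1..n} {1..n}"
    by (simp add: bij_betw_def endo_inj_surj)
  show "perm_of_word w i = i" if "i \<notin> {1..n}" for i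
    using that by (auto simp: perm_of_word_def len)
qed

text \<open>The lengths must agree: \<open>perm_of_word\<close> is the identity beyond the word, so
  \<open>[1]\<close> and \<open>[1, 2]\<close> give the same function.\<close>

lemma perm_of_word_inject:
  assumes "length v = length w" "perm_of_word v = perm_of_word w"
  shows "v = w"
proof (rule nth_equalityI[OF assms(1)])
  fix i assume "i < length v"
  then show "v ! i = w ! i"
    using fun_cong[OF assms(2), of "Suc i"] assms(1) by (simp add: perm_of_word_def)
qed

lemma Psi_permutes:
  assumes "p permutes {1..n}"
  shows "Psi n p permutes {1..n}"
  unfolding Psi_def using distinct_concat_standard_cycle_form[OF assms]
    set_concat_standard_cycle_form[OF assms] by (rule perm_of_word_permutes)

text \<open>Decoding in three stages: the function gives the word, the word its blocks, and the
  blocks the permutation.\<close>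

lemma Psi_inject:
  assumes p: "p permutes {1..n}" and q: "q permutes {1..n}" and "Psi n p = Psi n q"
  shows "p = q"
proof -
  have "concat (standard_cycle_form n p) = concat (standard_cycle_form n q)"
    using assms(3) unfolding Psi_def
    by (intro perm_of_word_inject) (simp_all only: length_concat_standard_cycle_form[OF p]
        length_concat_standard_cycle_form[OF q])
  then show ?thesis
    using std_form_concat_inject std_form_standard_cycle_form standard_cycle_form_inject p q
    by blast
qed

text \<open>No inverse is constructed: an injective self-map of a finite set is onto.\<close>

lemma bij_betw_Psi: "bij_betw (Psi n) (Sym n) (Sym n)"
proof -
  have "inj_on (Psi n) (Sym n)"
    by (auto simp: inj_on_def Sym_def simp del: One_nat_def intro: Psi_inject)
  moreover have "Psi n ` Sym n \<subseteq> Sym n"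
    by (auto simp: Sym_def simp del: One_nat_def intro: Psi_permutes)
  moreover have "finite (Sym n)"
    unfolding Sym_def by (rule finite_permutations) simp
  ultimately show ?thesis
    by (simp add: bij_betw_def endo_inj_surj)
qed

section \<open>Left-to-right minima and patterns under inversion\<close>

definition lr_minima :: "nat \<Rightarrow> (nat \<Rightarrow> nat) \<Rightarrow> nat set" where
  "lr_minima n w = {i \<in> {1..n}. \<forall>j\<in>{1..<i}. w i < w j}"

lemma num_cycles_eq_card_lr_minima:
  assumes "p permutes {1..n}"
  shows "num_cycles n p = card (lr_minima n (Psi n p))"
proof -
  let ?w = "concat (standard_cycle_form n p)"
  let ?L = "{i. i < length ?w \<and> (\<forall>j<i. ?w ! i < ?w ! j)}"
  have len: "length ?w = n"
    by (rule length_concat_standard_cycle_form[OF assms])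
  \<comment> \<open>Positions of a permutation start at 1, list indices at 0.\<close>
  have "lr_minima n (Psi n p) = Suc ` ?L"
  proof (intro set_eqI)
    fix i
    show "i \<in> lr_minima n (Psi n p) \<longleftrightarrow> i \<in> Suc ` ?L"
    proof (cases i)
      case 0
      then show ?thesis by (auto simp: lr_minima_def)
    next
      case (Suc k)
      have "(\<forall>j\<in>{1..<Suc k}. Q j) \<longleftrightarrow> (\<forall>j<k. Q (Suc j))" for Q
        by (metis (no_types, lifting) Suc_le_mono Suc_less_eq atLeastLessThan_iff le0
            not0_implies_Suc One_nat_def not_one_le_zero)
      then show ?thesis
        by (auto simp: Suc lr_minima_def Psi_def perm_of_word_def len image_iff)
    qed
  qed
  then show ?thesis
    using card_left_to_right_minima[OF std_form_standard_cycle_form[OF assms]]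
      length_standard_cycle_form[OF assms] by (simp add: card_image)
qed

lemma lr_minima_image_subset:
  assumes "w permutes {1..n}"
  shows "w ` lr_minima n w \<subseteq> lr_minima n (inv w)"
proof clarify
  fix i assume "i \<in> lr_minima n w"
  then have i: "i \<in> {1..n}" and min: "\<And>j. j \<in> {1..<i} \<Longrightarrow> w i < w j"
    by (auto simp: lr_minima_def)
  have "i < inv w b" if b: "b \<in> {1..<w i}" for b
  \<comment> \<open>Otherwise the smaller value \<open>b\<close> stands at a position at most
    \<open>i\<close>, in fact before \<open>i\<close> because \<open>b\<close> differs from
    \<open>w i\<close>; this contradicts minimality at \<open>i\<close>.\<close>
  proof (rule ccontr)
    assume "\<not> i < inv w b"
    have wb: "w (inv w b) = b"
      using assms by (simp add: permutes_inverses)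
    have "w i \<in> {1..n}"
      using i permutes_in_image[OF assms] by blast
    then have "inv w b \<in> {1..n}"
      using b permutes_in_image[OF permutes_inv[OF assms], of b] by auto
    moreover have "inv w b \<noteq> i"
      using wb b by auto
    ultimately have "w i < w (inv w b)"
      using \<open>\<not> i < inv w b\<close> by (intro min) auto
    with wb b show False by simp
  qed
  then show "w i \<in> lr_minima n (inv w)"
    using i permutes_in_image[OF assms, of i]
    by (auto simp: lr_minima_def permutes_inverses[OF assms])
qed

text \<open>The inclusion just proved gives one inequality; applied to \<open>inv w\<close>, it
  gives the other.\<close>

lemma card_lr_minima_inv:
  assumes "w permutes {1..n}"
  shows "card (lr_minima n (inv w)) = card (lr_minima n w)"
proof -
  have fin: "finite (lr_minima n v)" for v
    by (simp add: lr_minima_def)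
  have le: "card (lr_minima n v) \<le> card (lr_minima n (inv v))" if "v permutes {1..n}" for v
    using card_mono[OF fin lr_minima_image_subset[OF that]]
    by (simp add: card_image inj_on_subset[OF permutes_inj[OF that]])
  show ?thesis
    using le[OF assms] le[OF permutes_inv[OF assms]] by (simp add: permutes_inv_inv[OF assms])
qed

text \<open>Sorting the three points by value puts the positions \<open>j\<close>, \<open>k\<close>,
  \<open>i\<close> in this order. As \<open>i < j < k\<close>, they form the pattern 2-3-1 in
  \<open>inv w\<close>.\<close>

lemma card_312_eq_card_231_inv:
  fixes w :: "nat \<Rightarrow> nat"
  assumes w: "w permutes {1..n}"
  shows "card {(i, j, k). 1 \<le> i \<and> i < j \<and> j < k \<and> k \<le> n \<and> w j < w k \<and> w k < w i} =
    card {(a, b, c). 1 \<le> a \<and> a < b \<and> b < c \<and> c \<le> n \<and>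
      inv w c < inv w a \<and> inv w a < inv w b}"
    (is "card ?A = card ?B")
proof (rule bij_betw_same_card)
  have w_in: "1 \<le> w i" "w i \<le> n" if "1 \<le> i" "i \<le> n" for i
    using that permutes_in_image[OF w, of i] by auto
  have inv_in: "1 \<le> inv w i" "inv w i \<le> n" if "1 \<le> i" "i \<le> n" for i
    using that permutes_in_image[OF permutes_inv[OF w], of i] by auto
  show "bij_betw (\<lambda>(i, j, k). (w j, w k, w i)) ?A ?B"
  proof (rule bij_betw_byWitness[where f' = "\<lambda>(a, b, c). (inv w c, inv w a, inv w b)"])
    show "(\<lambda>(i, j, k). (w j, w k, w i)) ` ?A \<subseteq> ?B"
    proof clarify
      fix i j k
      assume "1 \<le> i" "i < j" "j < k" "k \<le> n" "w j < w k" "w k < w i"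
      moreover from this have "w i \<le> n \<and> 1 \<le> w j"
        by (intro conjI w_in; linarith)
      ultimately show "1 \<le> w j \<and> w j < w k \<and> w k < w i \<and> w i \<le> n \<and>
          inv w (w i) < inv w (w j) \<and> inv w (w j) < inv w (w k)"
        by (simp add: permutes_inverses[OF w])
    qed
    show "(\<lambda>(a, b, c). (inv w c, inv w a, inv w b)) ` ?B \<subseteq> ?A"
    proof clarify
      fix a b c
      assume "1 \<le> a" "a < b" "b < c" "c \<le> n" "inv w c < inv w a" "inv w a < inv w b"
      moreover from this have "inv w b \<le> n \<and> 1 \<le> inv w c"
        by (intro conjI inv_in; linarith)
      ultimately show "1 \<le> inv w c \<and> inv w c < inv w a \<and> inv w a < inv w b \<and> inv w b \<le> n \<and>
          w (inv w a) < w (inv w b) \<and> w (inv w b) < w (inv w c)"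
        by (simp add: permutes_inverses[OF w])
    qed
  qed (auto simp: permutes_inverses[OF w])
qed

theorem mainTheorem12:
  fixes n :: nat
  shows "(\<forall>p \<in> Sym n. Delta n p \<in> Sym n \<and> Delta n (Delta n p) = p) \<and>
    (\<forall>p \<in> Sym n. num_cycles n (Delta n p) = num_cycles n p) \<and>
    (\<forall>p \<in> Sym n. \<forall>k. card (cyclic_occ_312 n p) = k \<longrightarrow>
        card (cyclic_occ_231 n (Delta n p)) = k)"
proof -
  \<comment> \<open>Because \<open>Psi n\<close> is onto, \<open>inv_into\<close> returns a genuine
    preimage. So \<open>Psi n\<close> carries \<open>Delta n\<close> to inversion, and each claim
    reduces to one about \<open>Psi n p\<close> and its inverse.\<close>
  have facts: "Psi n p permutes {1..n} \<and> Delta n p \<in> Sym n \<and> Psi n (Delta n p) = inv (Psi n p)"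
    if "p \<in> Sym n" for p
  proof -
    have perm: "Psi n p permutes {1..n}"
      using that Psi_permutes by (simp add: Sym_def)
    then have "inv (Psi n p) \<in> Psi n ` Sym n"
      using bij_betw_imp_surj_on[OF bij_betw_Psi] permutes_inv by (simp add: Sym_def)
    with perm show ?thesis
      by (simp add: Delta_def inv_into_into f_inv_into_f)
  qed
  have "Delta n (Delta n p) = p" if p: "p \<in> Sym n" for p
  proof -
    have "Delta n (Delta n p) = inv_into (Sym n) (Psi n) (Psi n p)"
      unfolding Delta_def[of n "Delta n p"] using facts[OF p] permutes_inv_inv by metis
    also have "\<dots> = p"
      using bij_betw_imp_inj_on[OF bij_betw_Psi] p by (rule inv_into_f_f)
    finally show ?thesis .
  qed
  moreover have "num_cycles n (Delta n p) = num_cycles n p" if p: "p \<in> Sym n" for p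
    using facts[OF p] p card_lr_minima_inv[of "Psi n p" n]
    by (simp add: Sym_def num_cycles_eq_card_lr_minima)
  moreover have "card (cyclic_occ_231 n (Delta n p)) = card (cyclic_occ_312 n p)"
    if p: "p \<in> Sym n" for p
    using facts[OF p] card_312_eq_card_231_inv[of "Psi n p" n]
    by (simp add: cyclic_occ_231_def cyclic_occ_312_def)
  ultimately show ?thesis
    using facts by auto
qed

end
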